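(* Let $m\ge 1$, $M=2^m$, $L\ge 2$. Assume that one chooses a set $\Gamma=\{\pi_1,\dots,\pi_L\}$ of $L$ distinct permutations of $\{1,\dots,m\}$ randomly for the $M\times LM$ binary Golay spreading matrix $\Phi$. Let $B_{k_1,k_2}$ be the symplectic matrix corresponding to a permutation pair $\pi_{k_1}$ and $\pi_{k_2}$ in $\Gamma$, where $k_1\ne k_2$, and let $p_r$ be the probability of $\operatorname{rank}_2(B_{k_1,k_2})=r$, where $r$ is an even integer with $0\le r\le m$. Then $\mu(\Phi)=\frac{1}{\sqrt{2^r}}$ with probability $$P_r=\Bigl(\sum_{h=r/2}^{\lfloor m/2\rfloor}p_{2h}\Bigr)^{\frac{L(L-1)}{2}}-\Bigl(\sum_{h=r/2+1}^{\lfloor m/2\rfloor}p_{2h}\Bigr)^{\frac{L(L-1)}{2}},$$ where an empty sum is $0$.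
   Context: $\mathbb{Z}_2=\{0,1\}$ with addition modulo 2. For a permutation $\pi$ of $\{1,\dots,m\}$ define the quadratic form $\mathcal{Q}_\pi(x)=\sum_{r=1}^{m-1}x_{\pi(r)}x_{\pi(r+1)}$ over $\mathbb{Z}_2$, $x=(x_1,\dots,x_m)\in\mathbb{Z}_2^m$. For $0\le c\le 2^m-1$ with $c=\sum_{r=1}^m v_r2^{r-1}$, $v_r\in\mathbb{Z}_2$, let $\mathcal{L}_c(x)=\sum_{r=1}^m v_rx_r$ (mod 2). Let $M=2^m$. For $0\le i\le M-1$ write $i=\sum_{l=1}^m i_l2^{l-1}$ with $i_l\in\mathbb{Z}_2$. Let $b_\pi^{(c)}\in\{\pm1\}^M$ be the real column vector whose $i$-th entry is $(-1)^{\mathcal{Q}_\pi(i_1,\dots,i_m)+\mathcal{L}_c(i_1,\dots,i_m)}$. For permutations $\pi_1,\dots,\pi_L$, put $\Phi_k=[b_{\pi_k}^{(0)},b_{\pi_k}^{(1)},\dots,b_{\pi_k}^{(M-1)}]$ (an $M\times M$ matrix); the binary Golay spreading matrix is $\Phi=\frac1{\sqrt M}[\Phi_1,\dots,\Phi_L]$. The coherence of a matrix $A$ with nonzero columns $\phi_1,\dots,\phi_N$ is $\mu(A)=\max_{1\le j_1\ne j_2\le N}\frac{|\langle\phi_{j_1},\phi_{j_2}\rangle|}{\|\phi_{j_1}\|_2\|\phi_{j_2}\|_2}$ (maximum over distinct column indices). For each $k$, let $Q_k$ be the $m\times m$ upper triangular matrix over $\mathbb{Z}_2$ with $\mathcal{Q}_{\pi_k}(x)=xQ_kx^T$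 (i.e. the $(i,j)$ entry, $i<j$, is 1 iff $x_ix_j$ occurs in $\mathcal{Q}_{\pi_k}$, and all other entries are 0). For $k_1\ne k_2$ let $Q_{k_1,k_2}=Q_{k_1}+Q_{k_2}$; the symplectic matrix of the pair is $B_{k_1,k_2}=Q_{k_1,k_2}+Q_{k_1,k_2}^T$ (over $\mathbb{Z}_2$). $\operatorname{rank}_2$ denotes rank over $\mathbb{Z}_2$; the rank of each $B_{k_1,k_2}$ is an even integer between $0$ and $m$.
   Formalization: The formal theorem adds that the ranks of all L(L-1)/2 symplectic matrices are mutually independent (the random choice need not be uniform); without this the formula is false, e.g. uniform choice with m=L=3 gives probability 2/5 for r=2, not 64/125. *)

theory Defs
  imports
    "HOL-Probability.Probability"
    "HOL-Library.Z2"
    "HOL-Combinatorics.Permutations"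
    "Jordan_Normal_Form.DL_Rank"
begin

text \<open>
  Elements of \<open>\<int>\<^sub>2\<^sup>m\<close> are functions \<open>x :: nat \<Rightarrow> bit\<close> of which only the
  coordinates \<open>x 1, \<dots>, x m\<close> are used, and a permutation of \<open>{1, \<dots>, m}\<close> is a
  function \<open>\<sigma>\<close> with \<open>\<sigma> permutes {1..m}\<close>.  Matrices and vectors are those of
  Jordan_Normal_Form, whose rows and columns are numbered from 0.
\<close>

definition quad_form :: "nat \<Rightarrow> (nat \<Rightarrow> nat) \<Rightarrow> (nat \<Rightarrow> bit) \<Rightarrow> bit" where
  "quad_form m \<sigma> x = (\<Sum>r = 1..m - 1. x (\<sigma> r) * x (\<sigma> (r + 1)))"

text \<open>The digit \<open>i\<^sub>l\<close> (\<open>l \<ge> 1\<close>) in \<open>i = (\<Sum>l = 1..m. i\<^sub>l * 2 ^ (l - 1))\<close>.\<close>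

definition bin_digit :: "nat \<Rightarrow> nat \<Rightarrow> bit" where
  "bin_digit i l = of_bool (bit i (l - 1))"

definition lin_form :: "nat \<Rightarrow> nat \<Rightarrow> (nat \<Rightarrow> bit) \<Rightarrow> bit" where
  "lin_form m c x = (\<Sum>r = 1..m. bin_digit c r * x r)"

definition sign_of_bit :: "bit \<Rightarrow> real" where
  "sign_of_bit b = (if b = 0 then 1 else -1)"

definition golay_vec :: "nat \<Rightarrow> (nat \<Rightarrow> nat) \<Rightarrow> nat \<Rightarrow> real vec" where
  "golay_vec m \<sigma> c =
     vec (2 ^ m) (\<lambda>i. sign_of_bit (quad_form m \<sigma> (bin_digit i) + lin_form m c (bin_digit i)))"

definition golay_block :: "nat \<Rightarrow> (nat \<Rightarrow> nat) \<Rightarrow> real mat" where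
  "golay_block m \<sigma> = mat_of_cols (2 ^ m) (map (golay_vec m \<sigma>) [0..<2 ^ m])"

text \<open>
  The blocks of the permutations \<open>\<pi> 1, \<dots>, \<pi> L\<close> side by side: column \<open>j\<close> is
  column \<open>j mod 2 ^ m\<close> of block number \<open>j div 2 ^ m + 1\<close>.
\<close>

definition golay_spreading_matrix :: "nat \<Rightarrow> nat \<Rightarrow> (nat \<Rightarrow> nat \<Rightarrow> nat) \<Rightarrow> real mat" where
  "golay_spreading_matrix m L \<pi> =
     (1 / sqrt (2 ^ m)) \<cdot>\<^sub>m
       mat (2 ^ m) (L * 2 ^ m)
         (\<lambda>(i, j). golay_block m (\<pi> (j div 2 ^ m + 1)) $$ (i, j mod 2 ^ m))"

definition l2_norm :: "real vec \<Rightarrow> real" where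
  "l2_norm v = sqrt (scalar_prod v v)"

definition coherence :: "real mat \<Rightarrow> real" where
  "coherence A =
     Max {\<bar>scalar_prod (col A i) (col A j)\<bar> / (l2_norm (col A i) * l2_norm (col A j)) | i j.
            i < dim_col A \<and> j < dim_col A \<and> i \<noteq> j}"

text \<open>The matrix entry with indices \<open>(i, j)\<close> belongs to the variables numbered
  \<open>Suc i\<close> and \<open>Suc j\<close>.\<close>

definition quad_matrix :: "nat \<Rightarrow> (nat \<Rightarrow> nat) \<Rightarrow> bit mat" where
  "quad_matrix m \<sigma> =
     mat m m (\<lambda>(i, j). of_bool (i < j \<and> (\<exists>r\<in>{1..m - 1}. {\<sigma> r, \<sigma> (r + 1)} = {Suc i, Suc j})))"

lemma quad_form_eq_quad_matrix:
  assumes "\<sigma> permutes {1..m}"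
  shows "quad_form m \<sigma> x =
    (\<Sum>i<m. \<Sum>j<m. x (Suc i) * quad_matrix m \<sigma> $$ (i, j) * x (Suc j))"
proof -
  let ?P = "\<lambda>i j. i < j \<and> (\<exists>r\<in>{1..m - 1}. {\<sigma> r, \<sigma> (r + 1)} = {Suc i, Suc j})"
  let ?h = "\<lambda>r. (min (\<sigma> r) (\<sigma> (r + 1)) - 1, max (\<sigma> r) (\<sigma> (r + 1)) - 1)"
  let ?S = "{z \<in> {..<m} \<times> {..<m}. ?P (fst z) (snd z)}"
  have inj: "\<sigma> a = \<sigma> b \<longleftrightarrow> a = b" for a b
    using permutes_inj[OF assms] by (simp add: inj_eq)
  have rng: "\<sigma> r \<in> {1..m}" "\<sigma> (r + 1) \<in> {1..m}" if "r \<in> {1..m - 1}" for r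
    using that unfolding permutes_in_image[OF assms] by auto
  have pair: "{Suc (fst (?h r)), Suc (snd (?h r))} = {\<sigma> r, \<sigma> (r + 1)}"
    "fst (?h r) < snd (?h r)" "?h r \<in> {..<m} \<times> {..<m}" if "r \<in> {1..m - 1}" for r
    using rng[OF that] inj[of r "r + 1"] by (auto simp: min_def max_def)
  have inj_h: "inj_on ?h {1..m - 1}"
  proof (rule inj_onI)
    fix r s assume rs: "r \<in> {1..m - 1}" "s \<in> {1..m - 1}" and "?h r = ?h s"
    then have "{\<sigma> r, \<sigma> (r + 1)} = {\<sigma> s, \<sigma> (s + 1)}"
      using pair(1)[of r] pair(1)[of s] by simp
    then show "r = s"
      unfolding doubleton_eq_iff inj by auto
  qed
  have img: "?h ` {1..m - 1} = ?S"
  proof (intro equalityI subsetI)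
    fix z assume "z \<in> ?h ` {1..m - 1}"
    then obtain r where r: "r \<in> {1..m - 1}" "z = ?h r" by blast
    show "z \<in> ?S"
      unfolding r(2) using pair[OF r(1)] r(1) by (intro CollectI conjI bexI[of _ r]) auto
  next
    fix z assume z: "z \<in> ?S"
    then obtain r where r: "r \<in> {1..m - 1}" "{\<sigma> r, \<sigma> (r + 1)} = {Suc (fst z), Suc (snd z)}"
      and lt: "fst z < snd z" by auto
    have "z = ?h r"
      using r(2) lt unfolding doubleton_eq_iff by (auto simp: min_def max_def prod_eq_iff)
    then show "z \<in> ?h ` {1..m - 1}" using r(1) by blast
  qed
  have "(\<Sum>i<m. \<Sum>j<m. x (Suc i) * quad_matrix m \<sigma> $$ (i, j) * x (Suc j)) =
      (\<Sum>z\<in>{..<m} \<times> {..<m}. if ?P (fst z) (snd z) then x (Suc (fst z)) * x (Suc (snd z)) else 0)"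
    unfolding sum.cartesian_product
  proof (intro sum.cong refl)
    fix z assume "z \<in> {..<m} \<times> {..<m}"
    then obtain i j where z: "z = (i, j)" "i < m" "j < m" by auto
    have Q: "quad_matrix m \<sigma> $$ (i, j) = of_bool (?P i j)"
      unfolding quad_matrix_def index_mat(1)[OF z(2,3)] by (rule prod.case)
    show "(case z of (i, j) \<Rightarrow> x (Suc i) * quad_matrix m \<sigma> $$ (i, j) * x (Suc j)) =
        (if ?P (fst z) (snd z) then x (Suc (fst z)) * x (Suc (snd z)) else 0)"
      unfolding z(1) prod.case fst_conv snd_conv Q of_bool_def
      by (cases "?P i j") (simp_all only: simp_thms if_True if_False mult_1_right mult_zero_right mult_zero_left)
  qed
  also have "\<dots> = (\<Sum>z\<in>?S. x (Suc (fst z)) * x (Suc (snd z)))"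
    by (rule sum.inter_filter[symmetric]) (intro finite_cartesian_product finite_lessThan)
  also have "\<dots> = (\<Sum>r = 1..m - 1. x (Suc (fst (?h r))) * x (Suc (snd (?h r))))"
    unfolding img[symmetric] sum.reindex[OF inj_h] o_def by (rule refl)
  also have "\<dots> = quad_form m \<sigma> x"
    unfolding quad_form_def
  proof (intro sum.cong refl)
    fix r assume "r \<in> {1..m - 1}"
    from pair(1)[OF this] show
      "x (Suc (fst (?h r))) * x (Suc (snd (?h r))) = x (\<sigma> r) * x (\<sigma> (r + 1))"
      unfolding doubleton_eq_iff by (elim disjE conjE) (simp_all only: mult.commute)
  qed
  finally show ?thesis by (rule sym)
qed

definition symplectic_matrix :: "nat \<Rightarrow> (nat \<Rightarrow> nat) \<Rightarrow> (nat \<Rightarrow> nat) \<Rightarrow> bit mat" where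
  "symplectic_matrix m \<sigma> \<tau> =
     (let Q = quad_matrix m \<sigma> + quad_matrix m \<tau> in Q + transpose_mat Q)"

definition symplectic_rank :: "nat \<Rightarrow> (nat \<Rightarrow> nat) \<Rightarrow> (nat \<Rightarrow> nat) \<Rightarrow> nat" where
  "symplectic_rank m \<sigma> \<tau> = vec_space.rank m (symplectic_matrix m \<sigma> \<tau>)"

text \<open>
  A random choice of \<open>L\<close> distinct permutations of \<open>{1..m}\<close> is a probability mass
  function on families \<open>\<pi>\<close>; only \<open>\<pi> 1, \<dots>, \<pi> L\<close> matter.  The distribution is not
  required to be uniform.
\<close>

definition random_permutation_choice :: "nat \<Rightarrow> nat \<Rightarrow> (nat \<Rightarrow> nat \<Rightarrow> nat) pmf \<Rightarrow> bool" where
  "random_permutation_choice m L D \<longleftrightarrow>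
     (\<forall>\<pi>\<in>set_pmf D. (\<forall>k\<in>{1..L}. \<pi> k permutes {1..m}) \<and> inj_on \<pi> {1..L})"

text \<open>
  Mutual independence of the ranks over all \<open>L * (L - 1) div 2\<close> unordered pairs.
  Under the uniform distribution on families of \<open>L \<ge> 3\<close> distinct permutations it
  fails (for \<open>m = L = 3\<close> all three ranks are 2 with probability 2/5, while each
  single rank is 2 with probability 4/5), so it has to be a condition on the
  distribution.
\<close>

definition independent_pair_ranks :: "nat \<Rightarrow> nat \<Rightarrow> (nat \<Rightarrow> nat \<Rightarrow> nat) pmf \<Rightarrow> bool" where
  "independent_pair_ranks m L D \<longleftrightarrow>
     prob_space.indep_vars (measure_pmf D) (\<lambda>_. count_space UNIV)
       (\<lambda>(k1, k2) \<pi>. symplectic_rank m (\<pi> k1) (\<pi> k2))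
       {(k1, k2). 1 \<le> k1 \<and> k1 < k2 \<and> k2 \<le> L}"

end

theory Submission
  imports Defs "Jordan_Normal_Form.Matrix_Kernel"
begin

text \<open>
  The inner product of a column of block \<open>k1\<close> with one of block \<open>k2\<close> is a Walsh
  coefficient \<open>W(c) = (\<Sum>x. (-1) ^ (f x + x \<bullet> c))\<close> of the quadratic form
  \<open>f\<close> with matrix \<open>Q\<^bsub>k1\<^esub> + Q\<^bsub>k2\<^esub>\<close>, whose polar form is given by the symplectic
  matrix \<open>B\<close>.  Substituting \<open>x + y\<close> for \<open>y\<close> in the double sum \<open>W(c) ^ 2\<close> leaves
  \<open>2 ^ m\<close> times the sum of an additive character over the kernel of \<open>B\<close>, so
  \<open>W(c) ^ 2\<close> is \<open>0\<close> or \<open>2 ^ (2 * m - rank B)\<close>.  By Fourier inversion not all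
  coefficients vanish, and since they are integers the rank is even.  Hence the coherence is
  \<open>1 / sqrt (2 ^ r)\<close> exactly when \<open>r\<close> is the minimum of the pair ranks, and by
  independence each event that all ranks are at least a given bound has product probability.
\<close>

section \<open>Counting column spaces, bit vectors and kernels\<close>

text \<open>A maximal independent set \<open>S\<close> of columns is a basis of the column space, so
  its vectors correspond to the coefficient functions on \<open>S\<close>, and \<open>rank A\<close>
  is the size of \<open>S\<close>.\<close>

lemma (in vec_space) card_col_space:
  assumes A: "A \<in> carrier_mat n nc"
  shows "card (col_space A) = CARD('a) ^ rank A"
proof -
  let ?C = "set (cols A)"
  let ?P = "\<lambda>T. T \<subseteq> ?C \<and> lin_indpt T"
  have C: "?C \<subseteq> carrier_vec n" using cols_dim A by blast
  obtain S where S: "maximal S ?P" and finS: "finite S"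
    using maximal_exists_superset[of ?C ?P "{}"] by (auto simp: lin_dep_def)
  from S have SC: "S \<subseteq> ?C" and li: "lin_indpt S" unfolding maximal_def by auto
  have Sc: "S \<subseteq> carrier_vec n" using SC C by blast
  have "?C \<subseteq> span S"
  proof
    fix v assume v: "v \<in> ?C"
    \<comment> \<open>A column outside the span could be added to \<open>S\<close> without losing
      independence, against maximality.\<close>
    show "v \<in> span S"
    proof (rule ccontr)
      assume nv: "v \<notin> span S"
      then have "v \<notin> S" using in_own_span Sc by auto
      moreover have "lin_indpt (S \<union> {v})"
        using lin_dep_iff_in_span[of S v] nv \<open>v \<notin> S\<close> v C Sc li by auto
      ultimately show False using S v SC unfolding maximal_def by blast
    qed
  qed
  then have span_eq: "span ?C = span S"
    using SC Sc span_is_monotone[OF SC] span_is_submodule[OF Sc] span_is_subset by (metis subset_antisym)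
  \<comment> \<open>Extensional functions give each choice of coefficients on \<open>S\<close>
    exactly one representative, so they can be counted.\<close>
  have bij: "bij_betw (\<lambda>a. lincomb a S) (S \<rightarrow>\<^sub>E UNIV) (span S)"
    unfolding bij_betw_def
  proof
    show "inj_on (\<lambda>a. lincomb a S) (S \<rightarrow>\<^sub>E UNIV)"
    proof (rule inj_onI)
      fix a b assume a: "a \<in> S \<rightarrow>\<^sub>E UNIV" and b: "b \<in> S \<rightarrow>\<^sub>E UNIV" and eq: "lincomb a S = lincomb b S"
      have "lincomb (\<lambda>v. a v - b v) S = 0\<^sub>v n"
      proof (rule eq_vecI)
        fix i assume "i < dim_vec (0\<^sub>v n :: 'a vec)"
        then have i: "i < n" by simp
        show "lincomb (\<lambda>v. a v - b v) S $ i = 0\<^sub>v n $ i"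
          using arg_cong[OF eq, of "\<lambda>v. v $ i"]
          by (simp add: lincomb_index[OF i Sc] i left_diff_distrib sum_subtractf)
      qed (simp add: lincomb_dim[OF finS Sc])
      then have "\<forall>v\<in>S. a v - b v = 0"
        using li finS unfolding lin_dep_def by (fastforce simp: class_ring_simps)
      then show "a = b" using a b by (intro PiE_ext) auto
    qed
    show "(\<lambda>a. lincomb a S) ` (S \<rightarrow>\<^sub>E UNIV) = span S"
    proof -
      have "lincomb a S \<in> (\<lambda>a. lincomb a S) ` (S \<rightarrow>\<^sub>E UNIV)" for a
        by (rule image_eqI[of _ _ "restrict a S"]) (use Sc in \<open>auto intro!: lincomb_cong\<close>)
      then show ?thesis unfolding finite_span[OF finS Sc] by auto
    qed
  qed
  show ?thesis
    unfolding col_space_def span_eq bij_betw_same_card[OF bij, symmetric]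
      rank_card_indpt[OF A S] by (simp add: card_PiE[OF finS])
qed

lemma CARD_bit: "CARD(bit) = 2"
proof -
  have "(UNIV :: bit set) = {0, 1}" using bit_not_zero_iff by blast
  then have "CARD(bit) = card {0 :: bit, 1}" by (rule arg_cong)
  then show ?thesis by simp
qed

text \<open>This encodes both row indices, as points of Z_2^m, and column labels, as coefficient
  vectors of linear forms. Vector coordinates start at 0 but digits at 1, hence
  \<open>Suc l\<close>.\<close>

definition bits_vec :: "nat \<Rightarrow> nat \<Rightarrow> bit vec" where
  "bits_vec m i = vec m (\<lambda>l. bin_digit i (Suc l))"

lemma bits_vec_carrier [simp]: "bits_vec m i \<in> carrier_vec m"
  by (simp add: bits_vec_def)

lemma bij_betw_bits_vec: "bij_betw (bits_vec m) {..<2 ^ m} (carrier_vec m)"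
proof (rule bij_betw_imageI)
  show "inj_on (bits_vec m) {..<2 ^ m}"
  proof (rule inj_onI)
    fix i j :: nat assume ij: "i \<in> {..<2 ^ m}" "j \<in> {..<2 ^ m}" and eq: "bits_vec m i = bits_vec m j"
    have "bit i l = bit j l" if "l < m" for l
      using arg_cong[OF eq, of "\<lambda>v. v $ l"] that
      by (simp add: bits_vec_def bin_digit_def of_bool_eq_iff del: bit_not_zero_iff)
    then have "take_bit m i = take_bit m j"
      by (intro bit_eqI) (auto simp: bit_take_bit_iff)
    then show "i = j" using ij by (simp add: take_bit_nat_eq_self)
  qed
  show "bits_vec m ` {..<2 ^ m} = carrier_vec m"
  proof
    show "carrier_vec m \<subseteq> bits_vec m ` {..<2 ^ m}"
    proof
      fix v :: "bit vec" assume v: "v \<in> carrier_vec m"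
      let ?bs = "map (\<lambda>l. v $ l = 1) [0..<m]"
      \<comment> \<open>The preimage of \<open>v\<close> is the number whose binary digits, lowest
        first, are the coordinates of \<open>v\<close>.\<close>
      let ?i = "horner_sum of_bool 2 ?bs :: nat"
      have "v = bits_vec m ?i"
        using v by (intro eq_vecI)
          (auto simp: bits_vec_def bin_digit_def bit_horner_sum_bit_iff)
      moreover have "?i < 2 ^ m"
        using horner_sum_of_bool_2_less[of ?bs, where ?'a = nat] by simp
      ultimately show "v \<in> bits_vec m ` {..<2 ^ m}" by blast
    qed
  qed (auto)
qed

lemma finite_bit_vec [simp]: "finite (carrier_vec m :: bit vec set)"
  using bij_betw_finite[OF bij_betw_bits_vec] by blast

lemma card_bit_vec [simp]: "card (carrier_vec m :: bit vec set) = 2 ^ m"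
  using bij_betw_same_card[OF bij_betw_bits_vec, of m] by simp

text \<open>Rank-nullity in counted form: every nonempty fibre of multiplication by \<open>A\<close>
  is a translate of the kernel, so the fibres over the column space all have the same size.\<close>

lemma card_mat_kernel_bit:
  fixes A :: "bit mat"
  assumes A: "A \<in> carrier_mat n m"
  shows "card (mat_kernel A) * 2 ^ vec_space.rank n A = 2 ^ m"
proof -
  interpret vec_space "TYPE(bit)" n .
  let ?V = "carrier_vec m :: bit vec set"
  have img: "col_space A = (\<lambda>x. A *\<^sub>v x) ` ?V"
    unfolding col_space_eq[OF A] using A by auto
  have fib: "card {x \<in> ?V. A *\<^sub>v x = y} = card (mat_kernel A)" if "y \<in> col_space A" for y
  proof -
    obtain z where z: "z \<in> ?V" "y = A *\<^sub>v z" using \<open>y \<in> col_space A\<close> img by auto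
    have zz: "z + (z + x) = x" "z + x \<in> ?V" if "x \<in> ?V" for x
    proof -
      have "a + (a + b) = b" for a b :: bit by (cases a; cases b) simp_all
      then show "z + (z + x) = x" using that z(1) by (intro eq_vecI) (auto simp del: add_bit_eq_xor)
    qed (use z that in auto)
    have uu: "y + y = 0\<^sub>v n"
    proof -
      have "a + a = 0" for a :: bit by (cases a) simp_all
      then show ?thesis using z A by (intro eq_vecI) (auto simp del: add_bit_eq_xor)
    qed
    have dist: "A *\<^sub>v (z + x) = y + A *\<^sub>v x" if "x \<in> ?V" for x
      using mult_add_distrib_mat_vec[OF A z(1) that] z(2) by simp
    have yc: "y \<in> carrier_vec n" using z A by auto
    \<comment> \<open>In characteristic 2 translation by \<open>z\<close> is its own inverse; it
      exchanges the kernel with the fibre over \<open>y\<close>.\<close>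
    have "bij_betw (\<lambda>x. z + x) (mat_kernel A) {x \<in> ?V. A *\<^sub>v x = y}"
      using A yc by (intro bij_betwI[where g = "\<lambda>x. z + x"])
        (auto simp: mat_kernel_def zz dist uu)
    then show ?thesis by (simp add: bij_betw_same_card)
  qed
  have "2 ^ m = card ?V" by simp
  also have "\<dots> = (\<Sum>y\<in>col_space A. card {x \<in> ?V. A *\<^sub>v x = y})"
    unfolding img card_eq_sum by (rule sum.group[symmetric]) auto
  also have "\<dots> = card (col_space A) * card (mat_kernel A)" by (simp add: fib)
  finally show ?thesis using card_col_space[OF A] by (simp add: CARD_bit mult.commute)
qed


section \<open>Signs and character sums over Z_2\<close>

lemma sign_of_bit_add: "sign_of_bit (a + b) = sign_of_bit a * sign_of_bit b"
  by (cases a; cases b) (simp_all add: sign_of_bit_def)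

lemma sign_of_bit_neq_0 [simp]: "sign_of_bit a \<noteq> 0"
  by (simp add: sign_of_bit_def)

lemma sign_of_bit_cancel [simp]: "sign_of_bit a * (sign_of_bit a * b) = b"
  by (simp add: sign_of_bit_def)

lemma bit_add_self: "a + a = 0" for a :: bit
  by (cases a) simp_all

lemma bit_add_left_cancel: "a + (a + b) = b" for a b :: bit
  by (cases a; cases b) simp_all

lemma bit_vec_add_left_cancel:
  "x \<in> carrier_vec m \<Longrightarrow> y \<in> carrier_vec m \<Longrightarrow> x + (x + y) = y" for x y :: "bit vec"
  by (intro eq_vecI) (auto simp: bit_add_left_cancel simp del: add_bit_eq_xor)

lemma bit_vec_add_self: "x \<in> carrier_vec m \<Longrightarrow> x + x = 0\<^sub>v m" for x :: "bit vec"
  by (intro eq_vecI) (auto simp: bit_add_self simp del: add_bit_eq_xor)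

text \<open>Translation by \<open>u\<close> is an involution of \<open>U\<close>, since
  \<open>u + u\<close> vanishes and \<open>U\<close> is closed under addition.\<close>

lemma sum_bit_vec_translate:
  fixes h :: "bit vec \<Rightarrow> 'a :: comm_monoid_add"
  assumes "U \<subseteq> carrier_vec m" "\<And>x y. x \<in> U \<Longrightarrow> y \<in> U \<Longrightarrow> x + y \<in> U" "u \<in> U"
  shows "(\<Sum>x\<in>U. h (u + x)) = (\<Sum>x\<in>U. h x)"
  by (rule sum.reindex_bij_witness[of _ "\<lambda>x. u + x" "\<lambda>x. u + x"])
    (use assms in \<open>auto simp: bit_vec_add_left_cancel[of _ m]\<close>)

text \<open>If \<open>g u = 1\<close> for some \<open>u\<close> in \<open>U\<close>, translating by
  \<open>u\<close> flips every sign, so the sum equals its own negative.\<close>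

lemma character_sum:
  fixes U :: "bit vec set"
  assumes U: "U \<subseteq> carrier_vec m" "\<And>x y. x \<in> U \<Longrightarrow> y \<in> U \<Longrightarrow> x + y \<in> U"
    and g: "\<And>x y. x \<in> U \<Longrightarrow> y \<in> U \<Longrightarrow> g (x + y) = g x + g y"
  shows "(\<Sum>x\<in>U. sign_of_bit (g x)) = (if \<forall>x\<in>U. g x = 0 then real (card U) else 0)"
proof (cases "\<forall>x\<in>U. g x = 0")
  case False
  then obtain u where u: "u \<in> U" "g u = 1" by auto
  have "(\<Sum>x\<in>U. sign_of_bit (g x)) = (\<Sum>x\<in>U. sign_of_bit (g (u + x)))"
    by (rule sum_bit_vec_translate[OF U u(1), symmetric])
  also have "\<dots> = - (\<Sum>x\<in>U. sign_of_bit (g x))"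
    unfolding sum_negf[symmetric]
    by (intro sum.cong refl) (simp add: g u sign_of_bit_add sign_of_bit_def[of 1] del: add_bit_eq_xor)
  finally show ?thesis using False by auto
qed (simp add: sign_of_bit_def)

text \<open>Testing against unit vectors shows that only \<open>c = 0\<^sub>v m\<close> gives the
  trivial character.\<close>

lemma character_sum_scalar_prod:
  assumes "c \<in> carrier_vec m"
  shows "(\<Sum>x\<in>carrier_vec m. sign_of_bit (x \<bullet> c)) = (if c = 0\<^sub>v m then 2 ^ m else 0)"
proof -
  have "(\<forall>x\<in>carrier_vec m. x \<bullet> c = 0) \<longleftrightarrow> c = 0\<^sub>v m"
  proof
    assume *: "\<forall>x\<in>carrier_vec m. x \<bullet> c = 0"
    have "c $ i = 0" if "i < m" for i
      using *[rule_format, of "unit_vec m i"] assms that by simp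
    then show "c = 0\<^sub>v m" using assms by (intro eq_vecI) auto
  qed auto
  then show ?thesis
    using character_sum[of "carrier_vec m" m "\<lambda>x. x \<bullet> c"] assms
    by (simp add: add_scalar_prod_distrib[of _ m] del: add_bit_eq_xor)
qed

section \<open>Walsh coefficients of quadratic forms\<close>

text \<open>The Walsh-Hadamard transform of the sign function of \<open>f\<close>, without
  normalization.\<close>

definition walsh :: "nat \<Rightarrow> (bit vec \<Rightarrow> bit) \<Rightarrow> bit vec \<Rightarrow> real" where
  "walsh m f c = (\<Sum>x\<in>carrier_vec m. sign_of_bit (f x + x \<bullet> c))"

lemma walsh_square:
  fixes B :: "bit mat"
  assumes B: "B \<in> carrier_mat m m"
    and f: "\<And>x y. x \<in> carrier_vec m \<Longrightarrow> y \<in> carrier_vec m \<Longrightarrow> f (x + y) = f x + f y + x \<bullet> (B *\<^sub>v y)"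
    and c: "c \<in> carrier_vec m"
  shows "(walsh m f c)\<^sup>2 \<in> {0, 2 ^ m * real (card (mat_kernel B))}"
proof -
  let ?V = "carrier_vec m :: bit vec set" and ?s = sign_of_bit
  let ?h = "\<lambda>x. f x + x \<bullet> c"
  have h: "?h (x + y) = ?h x + ?h y + x \<bullet> (B *\<^sub>v y)" if "x \<in> ?V" "y \<in> ?V" for x y
    using that c by (simp add: f add_scalar_prod_distrib[of _ m] ac_simps del: add_bit_eq_xor)
  have K: "mat_kernel B \<subseteq> ?V" "\<And>x y. x \<in> mat_kernel B \<Longrightarrow> y \<in> mat_kernel B \<Longrightarrow> x + y \<in> mat_kernel B"
    using B by (auto simp: mat_kernel_def mult_add_distrib_mat_vec[of _ m m])
  have "(walsh m f c)\<^sup>2 = (\<Sum>x\<in>?V. \<Sum>y\<in>?V. ?s (?h x) * ?s (?h y))"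
    by (simp add: walsh_def power2_eq_square sum_product del: add_bit_eq_xor)
  also have "\<dots> = (\<Sum>x\<in>?V. \<Sum>y\<in>?V. ?s (?h x) * ?s (?h (x + y)))"
    by (intro sum.cong refl sum_bit_vec_translate[symmetric]) auto
  \<comment> \<open>Expanding \<open>?h (x + y)\<close> by \<open>h\<close> produces a second sign
    of \<open>?h x\<close>, which cancels the first.\<close>
  also have "\<dots> = (\<Sum>x\<in>?V. \<Sum>y\<in>?V. ?s (?h y) * ?s (x \<bullet> (B *\<^sub>v y)))"
  proof -
    have "?s a * ?s (a + b + d) = ?s b * ?s d" for a b d
      by (simp only: sign_of_bit_add mult.assoc sign_of_bit_cancel)
    then show ?thesis by (intro sum.cong refl) (simp only: h)
  qed
  also have "\<dots> = (\<Sum>y\<in>?V. ?s (?h y) * (\<Sum>x\<in>?V. ?s (x \<bullet> (B *\<^sub>v y))))"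
    by (subst sum.swap) (simp only: sum_distrib_left)
  \<comment> \<open>For fixed \<open>y\<close> the inner sum is a character sum in \<open>x\<close>,
    which vanishes unless \<open>B *\<^sub>v y\<close> is zero.\<close>
  also have "\<dots> = (\<Sum>y\<in>?V. if y \<in> mat_kernel B then ?s (?h y) * 2 ^ m else 0)"
    using B by (intro sum.cong refl) (auto simp: character_sum_scalar_prod mat_kernel_def simp del: add_bit_eq_xor)
  also have "\<dots> = 2 ^ m * (\<Sum>y\<in>mat_kernel B. ?s (?h y))"
    using K(1) by (simp add: sum.If_cases Int_absorb1 sum_distrib_left mult.commute del: add_bit_eq_xor)
  \<comment> \<open>On the kernel the polar term of \<open>h\<close> disappears, so
    \<open>?h\<close> is additive there and its signs form a character.\<close>
  also have "(\<Sum>y\<in>mat_kernel B. ?s (?h y)) = (if \<forall>x\<in>mat_kernel B. ?h x = 0 then real (card (mat_kernel B)) else 0)"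
    using K B by (intro character_sum[OF K])
      (auto simp: h mat_kernel_def simp del: add_bit_eq_xor)
  finally show ?thesis by auto
qed

text \<open>Fourier inversion at the origin: summing the coefficients over all \<open>c\<close>
  leaves only the term \<open>x = 0\<^sub>v m\<close>, of absolute value
  \<open>2 ^ m\<close>.\<close>

lemma walsh_nonzero: "\<exists>c\<in>carrier_vec m. walsh m f c \<noteq> 0"
proof (rule ccontr)
  let ?V = "carrier_vec m :: bit vec set" and ?s = sign_of_bit
  assume "\<not> ?thesis"
  then have "0 = (\<Sum>c\<in>?V. walsh m f c)" by simp
  also have "\<dots> = (\<Sum>x\<in>?V. ?s (f x) * (\<Sum>c\<in>?V. ?s (c \<bullet> x)))"
    unfolding walsh_def
    by (subst sum.swap) (simp add: sign_of_bit_add sum_distrib_left comm_scalar_prod[of _ m] del: add_bit_eq_xor)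
  also have "\<dots> = (\<Sum>x\<in>?V. if x = 0\<^sub>v m then ?s (f x) * 2 ^ m else 0)"
    by (intro sum.cong refl) (simp add: character_sum_scalar_prod del: add_bit_eq_xor)
  also have "\<dots> = ?s (f (0\<^sub>v m)) * 2 ^ m" by simp
  finally show False by simp
qed

text \<open>Division by \<open>2 ^ m\<close> anticipates the normalization of the columns, so that
  the quotients become correlations.\<close>

lemma walsh_spectrum:
  fixes B :: "bit mat"
  assumes B: "B \<in> carrier_mat m m"
    and f: "\<And>x y. x \<in> carrier_vec m \<Longrightarrow> y \<in> carrier_vec m \<Longrightarrow> f (x + y) = f x + f y + x \<bullet> (B *\<^sub>v y)"
  defines "r \<equiv> vec_space.rank m B"
  shows "c \<in> carrier_vec m \<Longrightarrow> \<bar>walsh m f c\<bar> / 2 ^ m \<in> {0, 1 / sqrt (2 ^ r)}"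
    and "\<exists>c\<in>carrier_vec m. \<bar>walsh m f c\<bar> / 2 ^ m = 1 / sqrt (2 ^ r)"
    and "even r"
proof -
  have ker: "real (card (mat_kernel B)) * 2 ^ r = 2 ^ m"
    using card_mat_kernel_bit[OF B] unfolding r_def by (metis of_nat_mult of_nat_numeral of_nat_power)
  \<comment> \<open>Since the kernel has \<open>2 ^ m / 2 ^ r\<close> elements, the only possible
    nonzero value of the squared coefficient is this square.\<close>
  have sq: "2 ^ m * real (card (mat_kernel B)) = (2 ^ m / sqrt (2 ^ r))\<^sup>2"
    unfolding power_divide ker[symmetric] by (simp add: field_simps power2_eq_square)
  have val: "\<bar>walsh m f c\<bar> / 2 ^ m = 1 / sqrt (2 ^ r)"
    if "c \<in> carrier_vec m" "walsh m f c \<noteq> 0" for c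
  proof -
    have "(walsh m f c)\<^sup>2 = (2 ^ m / sqrt (2 ^ r))\<^sup>2"
      using walsh_square[OF B f that(1)] that(2) unfolding sq by (metis insertE singletonD zero_eq_power2)
    then have "\<bar>walsh m f c\<bar> = 2 ^ m / sqrt (2 ^ r)"
      by (rule power2_eq_imp_eq[OF trans[OF power2_abs]]) simp_all
    then show ?thesis by simp
  qed
  show "c \<in> carrier_vec m \<Longrightarrow> \<bar>walsh m f c\<bar> / 2 ^ m \<in> {0, 1 / sqrt (2 ^ r)}"
    using val by (cases "walsh m f c = 0") auto
  obtain c where c: "c \<in> carrier_vec m" "walsh m f c \<noteq> 0" using walsh_nonzero by blast
  then show "\<exists>c\<in>carrier_vec m. \<bar>walsh m f c\<bar> / 2 ^ m = 1 / sqrt (2 ^ r)" using val by blast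
  have "walsh m f c \<in> \<int>"
    unfolding walsh_def sign_of_bit_def by (intro Ints_sum) auto
  then obtain k :: int where k: "walsh m f c = of_int k" by (rule Ints_cases)
  have "(of_int k)\<^sup>2 * 2 ^ r = (2 ^ (2 * m) :: real)"
  proof -
    have "\<bar>real_of_int k\<bar> * sqrt (2 ^ r) = 2 ^ m"
      using val[OF c] unfolding k by (simp add: field_simps)
    then have "(\<bar>real_of_int k\<bar> * sqrt (2 ^ r))\<^sup>2 = (2 ^ m)\<^sup>2" by (rule arg_cong)
    then show ?thesis by (simp add: power_mult_distrib power_even_eq)
  qed
  then have "of_int (k\<^sup>2 * 2 ^ r) = (of_int (2 ^ (2 * m)) :: real)" by simp
  then have eq: "k\<^sup>2 * 2 ^ r = 2 ^ (2 * m)" by (simp only: of_int_eq_iff)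
  have "k \<noteq> 0" using c k by auto
  \<comment> \<open>Comparing exponents of 2 on both sides of \<open>eq\<close>: the square
    contributes an even number, so \<open>r\<close> must be even.\<close>
  then have "multiplicity 2 (k\<^sup>2 * 2 ^ r) = 2 * multiplicity 2 k + r"
    by (subst prime_elem_multiplicity_mult_distrib) (auto simp: prime_elem_multiplicity_power_distrib)
  then have "2 * multiplicity 2 k + r = 2 * m" unfolding eq by simp
  then show "even r" by (metis dvd_add_right_iff dvd_triv_left)
qed

section \<open>Polarization and symplectic matrices\<close>

text \<open>The two mixed terms of the expansion merge once
  \<open>y \<bullet> (Q *\<^sub>v x)\<close> is rewritten with the transpose.\<close>

lemma quadratic_polarization:
  fixes Q :: "'a :: comm_ring_1 mat"
  assumes Q: "Q \<in> carrier_mat m m" and x: "x \<in> carrier_vec m" and y: "y \<in> carrier_vec m"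
  shows "(x + y) \<bullet> (Q *\<^sub>v (x + y)) =
    x \<bullet> (Q *\<^sub>v x) + y \<bullet> (Q *\<^sub>v y) + x \<bullet> ((Q + transpose_mat Q) *\<^sub>v y)"
proof -
  have Qv: "Q *\<^sub>v x \<in> carrier_vec m" "Q *\<^sub>v y \<in> carrier_vec m" "transpose_mat Q *\<^sub>v y \<in> carrier_vec m"
    using Q x y by auto
  have "y \<bullet> (Q *\<^sub>v x) = x \<bullet> (transpose_mat Q *\<^sub>v y)"
    using transpose_vec_mult_scalar[OF Q x y] comm_scalar_prod[OF x Qv(3)] by simp
  moreover have "(Q + transpose_mat Q) *\<^sub>v y = Q *\<^sub>v y + transpose_mat Q *\<^sub>v y"
    using Q y by (intro add_mult_distrib_mat_vec) auto
  ultimately show ?thesis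
    using Q x y Qv
    by (simp add: mult_add_distrib_mat_vec[OF Q x y] add_scalar_prod_distrib[of _ m]
        scalar_prod_add_distrib[of _ m] ac_simps)
qed

lemma quad_matrix_carrier [simp]: "quad_matrix m \<sigma> \<in> carrier_mat m m"
  by (simp add: quad_matrix_def)

lemma symplectic_matrix_carrier: "symplectic_matrix m \<sigma> \<tau> \<in> carrier_mat m m"
  unfolding symplectic_matrix_def Let_def
  by (intro add_carrier_mat transpose_carrier_mat[THEN iffD2]) auto

text \<open>Lets column pairs taken in either order be matched with index pairs satisfying
  \<open>k1 < k2\<close>.\<close>

lemma symplectic_rank_commute: "symplectic_rank m \<sigma> \<tau> = symplectic_rank m \<tau> \<sigma>"
  unfolding symplectic_rank_def symplectic_matrix_def
    comm_add_mat[OF quad_matrix_carrier quad_matrix_carrier, of m \<sigma> \<tau>] by (rule refl)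

lemma symplectic_rank_le: "symplectic_rank m \<sigma> \<tau> \<le> m"
  unfolding symplectic_rank_def by (rule vec_space.rank_le_nc[OF symplectic_matrix_carrier])

text \<open>The quadratic part of the exponent in the entrywise product of a column for \<sigma> and
  one for \<tau>.\<close>

definition pair_form :: "nat \<Rightarrow> (nat \<Rightarrow> nat) \<Rightarrow> (nat \<Rightarrow> nat) \<Rightarrow> bit vec \<Rightarrow> bit" where
  "pair_form m \<sigma> \<tau> x = x \<bullet> ((quad_matrix m \<sigma> + quad_matrix m \<tau>) *\<^sub>v x)"

lemma pair_form_add:
  assumes "x \<in> carrier_vec m" "y \<in> carrier_vec m"
  shows "pair_form m \<sigma> \<tau> (x + y) =
    pair_form m \<sigma> \<tau> x + pair_form m \<sigma> \<tau> y + x \<bullet> (symplectic_matrix m \<sigma> \<tau> *\<^sub>v y)"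
  unfolding pair_form_def symplectic_matrix_def Let_def
  by (rule quadratic_polarization[OF _ assms]) simp

lemmas pair_form_spectrum =
  walsh_spectrum[OF symplectic_matrix_carrier pair_form_add, folded symplectic_rank_def]

section \<open>Inner products of Golay columns as Walsh coefficients\<close>

lemma scalar_prod_mult_mat_vec:
  assumes "x \<in> carrier_vec m" "Q \<in> carrier_mat m m"
  shows "x \<bullet> (Q *\<^sub>v x) = (\<Sum>i<m. \<Sum>j<m. x $ i * Q $$ (i, j) * x $ j)"
  using assms unfolding scalar_prod_def mult_mat_vec_def
  by (auto simp: scalar_prod_def sum_distrib_left mult.assoc lessThan_atLeast0 intro!: sum.cong)

lemma quad_form_bin_digit:
  assumes "\<sigma> permutes {1..m}"
  shows "quad_form m \<sigma> (bin_digit i) = bits_vec m i \<bullet> (quad_matrix m \<sigma> *\<^sub>v bits_vec m i)"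
  unfolding quad_form_eq_quad_matrix[OF assms]
    scalar_prod_mult_mat_vec[OF bits_vec_carrier quad_matrix_carrier]
  by (intro sum.cong refl) (simp add: bits_vec_def del: mult_bit_eq_and)

lemma lin_form_bin_digit:
  "lin_form m c (bin_digit i) = bits_vec m i \<bullet> bits_vec m c"
proof -
  have "lin_form m c (bin_digit i) = (\<Sum>r<m. bin_digit c (Suc r) * bin_digit i (Suc r))"
    unfolding lin_form_def
    by (rule sum.reindex_bij_witness[of _ Suc "\<lambda>r. r - 1"]) auto
  also have "\<dots> = bits_vec m i \<bullet> bits_vec m c"
    unfolding scalar_prod_def
    by (intro sum.cong) (auto simp: bits_vec_def mult.commute simp del: mult_bit_eq_and)
  finally show ?thesis .
qed

text \<open>Multiplying signs adds exponents: the quadratic parts combine to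
  \<open>pair_form\<close>, the labels add as bit vectors, and the sum over rows becomes one over
  Z_2^m.\<close>

lemma golay_vec_scalar_prod:
  assumes "\<sigma> permutes {1..m}" "\<tau> permutes {1..m}"
  shows "golay_vec m \<sigma> c \<bullet> golay_vec m \<tau> d =
    walsh m (pair_form m \<sigma> \<tau>) (bits_vec m c + bits_vec m d)"
proof -
  let ?s = sign_of_bit
  have "golay_vec m \<sigma> c \<bullet> golay_vec m \<tau> d =
      (\<Sum>i<2 ^ m. golay_vec m \<sigma> c $ i * golay_vec m \<tau> d $ i)"
    by (simp add: scalar_prod_def golay_vec_def lessThan_atLeast0)
  also have "\<dots> = (\<Sum>i<2 ^ m. ?s (pair_form m \<sigma> \<tau> (bits_vec m i) +
      bits_vec m i \<bullet> (bits_vec m c + bits_vec m d)))"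
  proof (intro sum.cong refl)
    fix i :: nat assume "i \<in> {..<2 ^ m}"
    then have i: "i < 2 ^ m" by simp
    let ?x = "bits_vec m i"
    have Q: "quad_matrix m \<rho> *\<^sub>v ?x \<in> carrier_vec m" for \<rho>
      by (rule mult_mat_vec_carrier[OF quad_matrix_carrier bits_vec_carrier])
    show "golay_vec m \<sigma> c $ i * golay_vec m \<tau> d $ i =
        ?s (pair_form m \<sigma> \<tau> ?x + ?x \<bullet> (bits_vec m c + bits_vec m d))"
      unfolding pair_form_def golay_vec_def index_vec[OF i] quad_form_bin_digit[OF assms(1)]
        quad_form_bin_digit[OF assms(2)] lin_form_bin_digit
        add_mult_distrib_mat_vec[OF quad_matrix_carrier quad_matrix_carrier bits_vec_carrier]
        scalar_prod_add_distrib[OF bits_vec_carrier Q Q]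
        scalar_prod_add_distrib[OF bits_vec_carrier bits_vec_carrier bits_vec_carrier]
        sign_of_bit_add by (simp only: ac_simps)
  qed
  also have "\<dots> = walsh m (pair_form m \<sigma> \<tau>) (bits_vec m c + bits_vec m d)"
    unfolding walsh_def by (rule sum.reindex_bij_betw[OF bij_betw_bits_vec])
  finally show ?thesis .
qed

text \<open>Within one block the quadratic parts cancel modulo 2, leaving a pure character sum. This
  gives both the column norms and the orthogonality inside a block.\<close>

lemma walsh_pair_form_self:
  assumes "c \<in> carrier_vec m"
  shows "walsh m (pair_form m \<sigma> \<sigma>) c = (if c = 0\<^sub>v m then 2 ^ m else 0)"
proof -
  have "quad_matrix m \<sigma> + quad_matrix m \<sigma> = 0\<^sub>m m m"
    by (intro eq_matI) (auto simp: quad_matrix_def bit_add_self simp del: add_bit_eq_xor)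
  moreover have "0\<^sub>m m m *\<^sub>v x = 0\<^sub>v m" if "x \<in> carrier_vec m" for x :: "bit vec"
    using that by (intro eq_vecI) auto
  ultimately have "pair_form m \<sigma> \<sigma> x = 0" if "x \<in> carrier_vec m" for x
    using that by (simp add: pair_form_def)
  then show ?thesis
    unfolding walsh_def character_sum_scalar_prod[OF assms, symmetric]
    by (intro sum.cong refl) (simp del: add_bit_eq_xor)
qed

lemma bits_vec_add_eq_0_iff:
  assumes "c < 2 ^ m" "d < 2 ^ m"
  shows "bits_vec m c + bits_vec m d = 0\<^sub>v m \<longleftrightarrow> c = d"
proof
  assume "bits_vec m c + bits_vec m d = 0\<^sub>v m"
  then have "bits_vec m d = bits_vec m c"
    using bit_vec_add_left_cancel[OF bits_vec_carrier bits_vec_carrier, of m c d]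
    by (metis bits_vec_carrier right_zero_vec)
  then show "c = d"
    using bij_betw_imp_inj_on[OF bij_betw_bits_vec] assms by (metis inj_onD lessThan_iff)
qed (simp add: bit_vec_add_self[OF bits_vec_carrier])

lemma golay_vec_carrier: "golay_vec m \<sigma> c \<in> carrier_vec (2 ^ m)"
  by (simp add: golay_vec_def)

lemma dim_col_golay_spreading_matrix [simp]:
  "dim_col (golay_spreading_matrix m L \<pi>) = L * 2 ^ m"
  by (simp add: golay_spreading_matrix_def)

lemma col_golay_spreading_matrix:
  assumes "j < L * 2 ^ m"
  shows "col (golay_spreading_matrix m L \<pi>) j =
    (1 / sqrt (2 ^ m)) \<cdot>\<^sub>v golay_vec m (\<pi> (j div 2 ^ m + 1)) (j mod 2 ^ m)"
  using assms
  by (intro eq_vecI)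
    (auto simp: golay_spreading_matrix_def golay_block_def mat_of_cols_index golay_vec_def)

lemma golay_correlation:
  assumes i: "i < L * 2 ^ m" and j: "j < L * 2 ^ m"
    and \<pi>: "\<And>k. k \<in> {1..L} \<Longrightarrow> \<pi> k permutes {1..m}"
  defines "\<Phi> \<equiv> golay_spreading_matrix m L \<pi>"
  shows "\<bar>col \<Phi> i \<bullet> col \<Phi> j\<bar> / (l2_norm (col \<Phi> i) * l2_norm (col \<Phi> j)) =
    \<bar>walsh m (pair_form m (\<pi> (i div 2 ^ m + 1)) (\<pi> (j div 2 ^ m + 1)))
      (bits_vec m (i mod 2 ^ m) + bits_vec m (j mod 2 ^ m))\<bar> / 2 ^ m"
proof -
  have blk: "\<pi> (i div 2 ^ m + 1) permutes {1..m}" if "i < L * 2 ^ m" for i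
    using that by (intro \<pi>) (auto simp: less_mult_imp_div_less Suc_le_eq)
  have sp: "col \<Phi> i \<bullet> col \<Phi> j = walsh m (pair_form m (\<pi> (i div 2 ^ m + 1)) (\<pi> (j div 2 ^ m + 1)))
      (bits_vec m (i mod 2 ^ m) + bits_vec m (j mod 2 ^ m)) / 2 ^ m"
    if "i < L * 2 ^ m" "j < L * 2 ^ m" for i j
    unfolding \<Phi>_def col_golay_spreading_matrix[OF that(1)] col_golay_spreading_matrix[OF that(2)]
      golay_vec_scalar_prod[OF blk[OF that(1)] blk[OF that(2)], symmetric]
    by (simp add: smult_scalar_prod_distrib[of _ "2 ^ m"] scalar_prod_smult_distrib[of _ "2 ^ m"]
        golay_vec_carrier)
  \<comment> \<open>A column paired with itself has label sum zero, where the Walsh coefficient is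
    \<open>2 ^ m\<close>.\<close>
  have nrm: "l2_norm (col \<Phi> i) = 1" if "i < L * 2 ^ m" for i
    unfolding l2_norm_def sp[OF that that] bit_vec_add_self[OF bits_vec_carrier]
    by (simp add: walsh_pair_form_self)
  show ?thesis unfolding nrm[OF i] nrm[OF j] sp[OF i j] by simp
qed

section \<open>Coherence as a function of the smallest pair rank\<close>

lemma inverse_sqrt_power2_le_iff: "1 / sqrt (2 ^ a) \<le> 1 / sqrt (2 ^ b) \<longleftrightarrow> b \<le> a" for a b :: nat
  by (simp add: divide_simps)

text \<open>Every correlation is 0 or \<open>1 / sqrt (2 ^ k)\<close> for the rank \<open>k\<close>
  of some pair of blocks, and each pair of blocks attains its value, so the maximum belongs to the
  smallest rank.\<close>

lemma coherence_golay_eq_iff: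
  assumes "L \<ge> 2" and \<pi>: "\<And>k. k \<in> {1..L} \<Longrightarrow> \<pi> k permutes {1..m}"
  shows "coherence (golay_spreading_matrix m L \<pi>) = 1 / sqrt (2 ^ r) \<longleftrightarrow>
    (\<forall>(k1, k2)\<in>{(k1, k2). 1 \<le> k1 \<and> k1 < k2 \<and> k2 \<le> L}. r \<le> symplectic_rank m (\<pi> k1) (\<pi> k2)) \<and>
    (\<exists>(k1, k2)\<in>{(k1, k2). 1 \<le> k1 \<and> k1 < k2 \<and> k2 \<le> L}. symplectic_rank m (\<pi> k1) (\<pi> k2) = r)"
proof -
  define M :: nat where "M = 2 ^ m"
  define \<Phi> where "\<Phi> = golay_spreading_matrix m L \<pi>"
  define corr where "corr i j = \<bar>col \<Phi> i \<bullet> col \<Phi> j\<bar> / (l2_norm (col \<Phi> i) * l2_norm (col \<Phi> j))" for i j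
  define rk where "rk k1 k2 = symplectic_rank m (\<pi> k1) (\<pi> k2)" for k1 k2
  define T where "T = {corr i j | i j. i < L * M \<and> j < L * M \<and> i \<noteq> j}"
  let ?I = "{(k1, k2). 1 \<le> k1 \<and> k1 < k2 \<and> k2 \<le> L}"
  have M: "M > 0" by (simp add: M_def)
  have coh: "coherence \<Phi> = Max T"
    by (simp add: coherence_def T_def corr_def \<Phi>_def M_def)
  have corr: "corr i j = \<bar>walsh m (pair_form m (\<pi> (i div M + 1)) (\<pi> (j div M + 1)))
      (bits_vec m (i mod M) + bits_vec m (j mod M))\<bar> / 2 ^ m"
    if "i < L * M" "j < L * M" for i j
    using golay_correlation[OF that[unfolded M_def] \<pi>] by (simp add: corr_def \<Phi>_def M_def)
  have rk_commute: "rk k1 k2 = rk k2 k1" for k1 k2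
    unfolding rk_def by (rule symplectic_rank_commute)
  have upper: "t = 0 \<or> (\<exists>(k1, k2)\<in>?I. t = 1 / sqrt (2 ^ rk k1 k2))" if "t \<in> T" for t
  proof -
    obtain i j where ij: "i < L * M" "j < L * M" "i \<noteq> j" and t: "t = corr i j"
      using \<open>t \<in> T\<close> unfolding T_def by blast
    have lt: "i div M < L" "j div M < L" using ij by (auto simp: less_mult_imp_div_less)
    show ?thesis
    proof (cases "i div M = j div M")
      case True
      \<comment> \<open>Distinct columns of one block have distinct labels, so their label sum is
        nonzero and they are orthogonal.\<close>
      then have "i mod M \<noteq> j mod M" using ij(3) by (metis div_mult_mod_eq)
      then have "bits_vec m (i mod M) + bits_vec m (j mod M) \<noteq> 0\<^sub>v m"
        using M bits_vec_add_eq_0_iff[of "i mod M" m "j mod M"] by (simp add: M_def)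
      then show ?thesis
        unfolding t corr[OF ij(1,2)] True by (simp add: walsh_pair_form_self)
    next
      case False
      have "t \<in> {0, 1 / sqrt (2 ^ rk (i div M + 1) (j div M + 1))}"
        unfolding t corr[OF ij(1,2)] rk_def by (rule pair_form_spectrum) auto
      moreover have "(i div M + 1, j div M + 1) \<in> ?I \<or> (j div M + 1, i div M + 1) \<in> ?I"
        using False lt by auto
      ultimately show ?thesis using rk_commute by fastforce
    qed
  qed
  have attained: "1 / sqrt (2 ^ rk k1 k2) \<in> T" if "(k1, k2) \<in> ?I" for k1 k2
  proof -
    obtain c where c: "c \<in> carrier_vec m"
      "\<bar>walsh m (pair_form m (\<pi> k1) (\<pi> k2)) c\<bar> / 2 ^ m = 1 / sqrt (2 ^ rk k1 k2)"
      using pair_form_spectrum(2)[of m "\<pi> k1" "\<pi> k2"] unfolding rk_def by blast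
    \<comment> \<open>Label 0 is used in block \<open>k2\<close>; the label \<open>a\<close> in
      block \<open>k1\<close> is chosen so that the two label vectors add up to
      \<open>c\<close>.\<close>
    obtain a where a: "a < M" "c + bits_vec m 0 = bits_vec m a"
      using bij_betw_imp_surj_on[OF bij_betw_bits_vec, of m] c(1) unfolding M_def
      by (metis add_carrier_vec bits_vec_carrier imageE lessThan_iff)
    have "bits_vec m a + bits_vec m 0 = c"
      unfolding a(2)[symmetric] using c(1)
      by (metis assoc_add_vec bit_vec_add_self bits_vec_carrier right_zero_vec)
    \<comment> \<open>Blocks are numbered from 1 and columns from 0, hence \<open>k1 - 1\<close> and
      \<open>k2 - 1\<close>.\<close>
    moreover define i j where "i = (k1 - 1) * M + a" and "j = (k2 - 1) * M"
    have div: "i div M = k1 - 1" "j div M = k2 - 1" "i mod M = a" "j mod M = 0"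
      using a(1) M by (auto simp: i_def j_def)
    have "(k1 - 1) * M + M \<le> L * M" "(k2 - 1) * M + M \<le> L * M"
      using that mult_le_mono1[of k1 L M] mult_le_mono1[of k2 L M]
      by (auto simp: diff_mult_distrib)
    then have "i < L * M" "j < L * M" using a(1) M unfolding i_def j_def by linarith+
    moreover have "i \<noteq> j" using div that by auto
    ultimately show ?thesis
      unfolding T_def using that corr[of i j] c(2) div by (intro CollectI exI[of _ i] exI[of _ j]) auto
  qed
  have fin: "finite T"
    by (rule finite_subset[of _ "(\<lambda>(i, j). corr i j) ` ({..<L * M} \<times> {..<L * M})"])
      (auto simp: T_def)
  have "(1, 2) \<in> ?I" using \<open>L \<ge> 2\<close> by auto
  then have "T \<noteq> {}" using attained by blast
  then have "coherence \<Phi> = 1 / sqrt (2 ^ r) \<longleftrightarrow> 1 / sqrt (2 ^ r) \<in> T \<and> (\<forall>t\<in>T. t \<le> 1 / sqrt (2 ^ r))"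
    unfolding coh by (rule Max_eq_iff[OF fin])
  also have "\<dots> \<longleftrightarrow> (\<forall>(k1, k2)\<in>?I. r \<le> rk k1 k2) \<and> (\<exists>(k1, k2)\<in>?I. rk k1 k2 = r)"
  proof (intro iffI conjI; elim conjE)
    assume T: "1 / sqrt (2 ^ r) \<in> T" "\<forall>t\<in>T. t \<le> 1 / sqrt (2 ^ r)"
    show "\<forall>(k1, k2)\<in>?I. r \<le> rk k1 k2"
      using T(2) attained inverse_sqrt_power2_le_iff by fast
    \<comment> \<open>Positivity excludes the zero alternative of \<open>upper\<close>.\<close>
    have "(1::real) / sqrt (2 ^ r) \<noteq> 0" by simp
    then obtain k1 k2 where k: "(k1, k2) \<in> ?I" "1 / sqrt (2 ^ r) = 1 / sqrt (2 ^ rk k1 k2)"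
      using upper[OF T(1)] by blast
    then have "rk k1 k2 = r"
      by (intro antisym) (metis inverse_sqrt_power2_le_iff order_refl)+
    then show "\<exists>(k1, k2)\<in>?I. rk k1 k2 = r" using k(1) by blast
  next
    assume ge: "\<forall>(k1, k2)\<in>?I. r \<le> rk k1 k2" and ex: "\<exists>(k1, k2)\<in>?I. rk k1 k2 = r"
    then show "1 / sqrt (2 ^ r) \<in> T" using attained by blast
    show "\<forall>t\<in>T. t \<le> 1 / sqrt (2 ^ r)"
    proof
      fix t assume "t \<in> T"
      from upper[OF this] show "t \<le> 1 / sqrt (2 ^ r)"
      proof
        assume "\<exists>(k1, k2)\<in>?I. t = 1 / sqrt (2 ^ rk k1 k2)"
        then show ?thesis using ge inverse_sqrt_power2_le_iff by fast
      qed simp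
    qed
  qed
  finally show ?thesis unfolding \<Phi>_def rk_def .
qed

section \<open>Probability of a given coherence\<close>

text \<open>Grouping by the larger index \<open>k2\<close> leaves \<open>k2 - 1\<close> choices for
  the smaller one.\<close>

lemma card_ordered_pairs: "card {(k1, k2). 1 \<le> k1 \<and> k1 < k2 \<and> k2 \<le> L} = L * (L - 1) div 2"
proof -
  have "{(k1, k2). 1 \<le> k1 \<and> k1 < k2 \<and> k2 \<le> L} = (\<lambda>(a, b). (b, a)) ` (SIGMA k2:{1..L}. {1..<k2})"
    by (auto simp: image_iff)
  then have "card {(k1, k2). 1 \<le> k1 \<and> k1 < k2 \<and> k2 \<le> L} = card (SIGMA k2:{1..L}. {1..<k2})"
    by (simp add: card_image inj_on_def)
  also have "\<dots> = (\<Sum>k = 1..L. k - 1)" by simp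
  also have "\<dots> = \<Sum>{0..<L}"
    by (rule sum.reindex_bij_witness[of _ Suc "\<lambda>k. k - 1"]) auto
  also have "\<dots> = L * (L - 1) div 2" by (simp add: Sum_Ico_nat)
  finally show ?thesis .
qed

theorem theorem2:
  fixes m L r :: nat
    and D :: "(nat \<Rightarrow> nat \<Rightarrow> nat) pmf"
    and p :: "nat \<Rightarrow> real"
  assumes "m \<ge> 1" and "L \<ge> 2"
    and "random_permutation_choice m L D"
    and "\<And>k1 k2 s. k1 \<in> {1..L} \<Longrightarrow> k2 \<in> {1..L} \<Longrightarrow> k1 \<noteq> k2 \<Longrightarrow> even s \<Longrightarrow> s \<le> m \<Longrightarrow>
           p s = measure_pmf.prob D {\<pi>. symplectic_rank m (\<pi> k1) (\<pi> k2) = s}"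
    and "independent_pair_ranks m L D"
    and "even r" and "r \<le> m"
  shows "measure_pmf.prob D {\<pi>. coherence (golay_spreading_matrix m L \<pi>) = 1 / sqrt (2 ^ r)} =
    (\<Sum>h = r div 2..m div 2. p (2 * h)) ^ (L * (L - 1) div 2) -
    (\<Sum>h = r div 2 + 1..m div 2. p (2 * h)) ^ (L * (L - 1) div 2)"
proof -
  let ?P = "measure_pmf.prob D"
  let ?I = "{(k1, k2). 1 \<le> k1 \<and> k1 < k2 \<and> k2 \<le> L}"
  define rk :: "nat \<times> nat \<Rightarrow> (nat \<Rightarrow> nat \<Rightarrow> nat) \<Rightarrow> nat"
    where "rk = (\<lambda>(k1, k2) \<pi>. symplectic_rank m (\<pi> k1) (\<pi> k2))"
  \<comment> \<open>The minimum rank equals \<open>r\<close> exactly on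
    \<open>E (r div 2) - E (r div 2 + 1)\<close>, which explains the difference of powers.\<close>
  define E where "E t = {\<pi>. \<forall>q\<in>?I. 2 * t \<le> rk q \<pi>}" for t
  have indep: "prob_space.indep_vars (measure_pmf D) (\<lambda>_. count_space UNIV) rk ?I"
    using assms(5) unfolding independent_pair_ranks_def rk_def .
  have finI: "finite ?I" by (rule finite_subset[of _ "{..L} \<times> {..L}"]) auto
  have "(1, 2) \<in> ?I" using assms(2) by simp
  then have I_ne: "?I \<noteq> {}" by blast
  \<comment> \<open>Both facts hold for every family, also outside the support of \<open>D\<close>,
    so the decomposition in \<open>single\<close> is an equality of sets.\<close>
  have rk_even: "even (rk q \<pi>)" and rk_le: "rk q \<pi> \<le> m" for q \<pi>
    unfolding rk_def by (auto split: prod.split intro: pair_form_spectrum(3) symplectic_rank_le)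
  have single: "?P {\<pi>. 2 * t \<le> rk q \<pi>} = (\<Sum>h = t..m div 2. p (2 * h))" if q: "q \<in> ?I" for q t
  proof -
    have "{\<pi>. 2 * t \<le> rk q \<pi>} = (\<Union>h\<in>{t..m div 2}. {\<pi>. rk q \<pi> = 2 * h})"
    proof safe
      fix \<pi> assume "2 * t \<le> rk q \<pi>"
      moreover obtain h where "rk q \<pi> = 2 * h" using rk_even by (rule evenE)
      moreover note rk_le[of q \<pi>]
      ultimately show "\<pi> \<in> (\<Union>h\<in>{t..m div 2}. {\<pi>. rk q \<pi> = 2 * h})"
        by (intro UN_I[of h]) auto
    qed auto
    then have "?P {\<pi>. 2 * t \<le> rk q \<pi>} = (\<Sum>h = t..m div 2. ?P {\<pi>. rk q \<pi> = 2 * h})"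
      by (simp only:, intro measure_pmf.finite_measure_finite_Union)
        (auto simp: disjoint_family_on_def)
    also have "\<dots> = (\<Sum>h = t..m div 2. p (2 * h))"
      using q by (intro sum.cong refl) (auto simp: rk_def assms(4)[symmetric])
    finally show ?thesis .
  qed
  have prob_E: "?P (E t) = (\<Sum>h = t..m div 2. p (2 * h)) ^ (L * (L - 1) div 2)" for t
  proof -
    have "E t = (\<Inter>q\<in>?I. rk q -` {2 * t..} \<inter> space (measure_pmf D))"
      by (auto simp: E_def)
    also have "?P \<dots> = (\<Prod>q\<in>?I. ?P (rk q -` {2 * t..} \<inter> space (measure_pmf D)))"
      by (intro prob_space.indep_varsD[OF measure_pmf.prob_space_axioms indep I_ne finI]) auto
    \<comment> \<open>All pairs share the same rank distribution \<open>p\<close>, so the factors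
      coincide and the number of pairs becomes the exponent.\<close>
    also have "\<dots> = (\<Prod>q\<in>?I. \<Sum>h = t..m div 2. p (2 * h))"
      by (intro prod.cong refl) (simp add: single[symmetric] vimage_def)
    finally show ?thesis by (simp only: prod_constant card_ordered_pairs)
  qed
  have r: "2 * (r div 2) = r" using assms(6) by simp
  have "?P {\<pi>. coherence (golay_spreading_matrix m L \<pi>) = 1 / sqrt (2 ^ r)} =
      ?P (E (r div 2) - E (r div 2 + 1))"
  \<comment> \<open>The events are compared only almost everywhere: the members of a family are
    known to be permutations just on the support of \<open>D\<close>.\<close>
  proof (rule measure_pmf.finite_measure_eq_AE)
    show "AE \<pi> in measure_pmf D.
        \<pi> \<in> {\<pi>. coherence (golay_spreading_matrix m L \<pi>) = 1 / sqrt (2 ^ r)} \<longleftrightarrow>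
        \<pi> \<in> E (r div 2) - E (r div 2 + 1)"
    proof (rule AE_pmfI)
      fix \<pi> assume "\<pi> \<in> set_pmf D"
      then have perm: "\<pi> k permutes {1..m}" if "k \<in> {1..L}" for k
        using assms(3) that unfolding random_permutation_choice_def by blast
      have coh: "coherence (golay_spreading_matrix m L \<pi>) = 1 / sqrt (2 ^ r) \<longleftrightarrow>
          (\<forall>q\<in>?I. r \<le> rk q \<pi>) \<and> (\<exists>q\<in>?I. rk q \<pi> = r)"
        by (subst coherence_golay_eq_iff[OF assms(2) perm]) (simp_all add: rk_def case_prod_beta')
      have E0: "\<pi> \<in> E (r div 2) \<longleftrightarrow> (\<forall>q\<in>?I. r \<le> rk q \<pi>)"
        unfolding E_def r by (rule mem_Collect_eq)
      have "(\<exists>q\<in>?I. rk q \<pi> = r) \<longleftrightarrow> \<pi> \<notin> E (r div 2 + 1)" if "\<pi> \<in> E (r div 2)"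
      proof -
        have "\<not> 2 * (r div 2 + 1) \<le> rk q \<pi> \<longleftrightarrow> rk q \<pi> = r" if "q \<in> ?I" for q
        proof -
          have "r \<le> rk q \<pi>" using \<open>\<pi> \<in> E (r div 2)\<close> that unfolding E0 by blast
          \<comment> \<open>Parity closes the gap: an even number that is at least \<open>s\<close>
            but below \<open>s + 2\<close> equals \<open>s\<close>.\<close>
          moreover have "\<not> 2 * (s div 2 + 1) \<le> x \<longleftrightarrow> x = s"
            if "s \<le> x" "even s" "even x" for s x :: nat
            using that by presburger
          ultimately show ?thesis using assms(6) rk_even by blast
        qed
        then show ?thesis unfolding E_def by blast
      qed
      then show "\<pi> \<in> {\<pi>. coherence (golay_spreading_matrix m L \<pi>) = 1 / sqrt (2 ^ r)} \<longleftrightarrow>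
          \<pi> \<in> E (r div 2) - E (r div 2 + 1)"
        unfolding mem_Collect_eq coh Diff_iff E0 by blast
    qed
  qed auto
  also have "\<dots> = ?P (E (r div 2)) - ?P (E (r div 2 + 1))"
    by (rule measure_pmf.finite_measure_Diff) (auto simp: E_def intro: Suc_leD)
  finally show ?thesis unfolding prob_E .
qed

end
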